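(* For every integer $n\ge 0$, $$ H_n(x) = \prod_{i=1}^n\frac{(6i+4)!\, (2i+1)!}{2\, (4 i+2)!\,(4i+3)!} \;\sum_{i=0}^n \frac{(-1)^i\, n!\,(4n+3)!!\, (3n+i+2)!\, (x-1)^i} {(3n+2)!\, i!\,(n-i)!\,(4n+2i+3)!!}. $$
   Context: For $k\ge 0$ let $a_k(x)=\sum_{m=0}^{k}\binom{3k+1-m}{k-m}x^m$, and for $n\ge 0$ let $H_n(x)=\det[a_{i+j}(x)]_{0\le i,j\le n}$ be the $(n+1)\times(n+1)$ Hankel determinant. Here $(2r+1)!!=1\cdot 3\cdot 5\cdots(2r+1)$ is the double factorial. Empty products equal $1$. *)

theory Defs
  imports "Jordan_Normal_Form.Determinant"
begin

text \<open>Truncated subtraction on \<^typ>\<open>nat\<close> agrees with integer subtraction in the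
  following definition, since \<open>m \<le> k\<close>. The argument
  \<open>x\<close> ranges over an arbitrary commutative ring, so it may in particular be an indeterminate.\<close>

definition hankel_coeff :: "nat \<Rightarrow> 'a::comm_ring_1 \<Rightarrow> 'a" where
  "hankel_coeff k x = (\<Sum>m=0..k. of_nat ((3 * k + 1 - m) choose (k - m)) * x ^ m)"

definition hankel_det :: "nat \<Rightarrow> 'a::comm_ring_1 \<Rightarrow> 'a" where
  "hankel_det n x = det (mat (n + 1) (n + 1) (\<lambda>(i, j). hankel_coeff (i + j) x))"

text \<open>The double factorial \<open>m!!\<close>.\<close>

fun dfact :: "nat \<Rightarrow> nat" where
  "dfact 0 = 1"
| "dfact (Suc 0) = 1"
| "dfact (Suc (Suc m)) = Suc (Suc m) * dfact m"

lemma dfact_odd: "dfact (2 * r + 1) = (\<Prod>j=0..r. 2 * j + 1)"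
  by (induction r) (simp_all add: algebra_simps)

end

theory Submission
  imports Defs "HOL-Computational_Algebra.Polynomial_FPS"
begin

text \<open>
  Put \<open>s = x - 1\<close> and \<open>c = -2 s\<close>. Then \<open>a\<^sub>k(x)\<close> is the coefficient of \<open>T^k\<close> in
  \<open>\<omega>\<^sub>k(T) = (1 + T)^(3k+2) / (1 - s T)\<close>. Let
  \<open>D(T, Q) = 1 - (3 T + T^2) Q - T Q^2\<close>; this is symmetric in \<open>T\<close> and \<open>Q\<close>, because
  \<open>(T - Q) D(T, Q) = T (1 + Q)^3 - Q (1 + T)^3\<close>.

  \<^emph>\<open>Removing the Hankel structure.\<close> The coefficient \<open>E(i, j)\<close> of \<open>T^i Q^j\<close> in
  \<open>\<omega>\<^sub>i(T) \<omega>\<^sub>j(Q) (1 + c T Q) / D(T, Q)\<close> satisfies \<open>E(i+1, j) = E(i, j+1)\<close>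
  (lemma \<open>hankel_gf_shift\<close>) and \<open>E(k, 0) = a\<^sub>k(x)\<close>, hence \<open>E(i, j) = a\<^sub>i\<^sub>+\<^sub>j(x)\<close>. Since
  \<open>\<omega>\<^sub>k\<close> has constant term 1, multiplication by it amounts to unitriangular row and
  column operations, and the Hankel determinant is the determinant of the coefficient matrix of
  \<open>(1 + c T Q) / D(T, Q)\<close>. A further column operation divides this series by \<open>D(c, Q)\<close>, and
  \<open>(T - c) (1 + c T Q) = T D(c, Q) - c D(T, Q)\<close> shows that the new columns are the
  coefficient sequences of the divided differences
  \<open>(T g\<^sub>j(T) - c g\<^sub>j(c)) / (T - c)\<close>, where \<open>1 / D(T, Q) = \<Sum>\<^sub>j g\<^sub>j(T) Q^j\<close>
  (lemma \<open>hankel_det_eq_det_shift_quot\<close>).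

  \<^emph>\<open>Evaluation.\<close> Subtracting \<open>c\<close> times row \<open>i + 1\<close> from row \<open>i\<close> turns the first \<open>n\<close>
  rows into the coefficients of the \<open>g\<^sub>j\<close> themselves. Suppose that \<open>g\<^sub>n\<close> plus a combination
  of \<open>g\<^sub>0, \<dots>, g\<^sub>n\<^sub>-\<^sub>1\<close> equals \<open>T^n p\<^sub>n(T)\<close> for a polynomial \<open>p\<^sub>n\<close>. The same combination of
  columns makes the last column \<open>(0, \<dots>, 0, p\<^sub>n(c))\<close>. For \<open>c = 0\<close> the divided differences are
  the \<open>g\<^sub>j\<close>, so this gives
  \<open>H\<^sub>n(x) = H\<^sub>n\<^sub>-\<^sub>1(1) p\<^sub>n(c)\<close>, and by induction \<open>H\<^sub>n(1) = p\<^sub>1(0) \<cdots> p\<^sub>n(0)\<close>.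

  \<^emph>\<open>The polynomials.\<close> The \<open>p\<^sub>n\<close> are the monic multiples of the hypergeometric polynomials
  \<open>\<^sub>2F\<^sub>1(-n, 3n+3; 2n+5/2; -T/4)\<close>. That \<open>T^n p\<^sub>n\<close> lies in the required span
  (lemma \<open>monom_jacobi_in_path_span\<close>) follows from a three-term recurrence
  \<open>p\<^sub>n\<^sub>+\<^sub>1 T^2 = ((1 + T)^3 - \<alpha>\<^sub>n T) p\<^sub>n - \<beta>\<^sub>n p\<^sub>n\<^sub>-\<^sub>1\<close>, as the multiplication by
  \<open>(1 + T)^3 / T\<close> maps each \<open>g\<^sub>j\<close> with \<open>j > 0\<close> to \<open>g\<^sub>j\<^sub>+\<^sub>1 + 3 g\<^sub>j + 3 g\<^sub>j\<^sub>-\<^sub>1 + g\<^sub>j\<^sub>-\<^sub>2\<close>.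
\<close>

section \<open>Lattice path polynomials and divided differences\<close>

text \<open>The coefficient \<open>g\<^sub>j\<close> of \<open>Q^j\<close> in \<open>1 / D(T, Q)\<close>, as a polynomial in \<open>T\<close>. The
  coefficient of \<open>T^i\<close> in it counts the lattice paths from \<open>(0, 0)\<close> to \<open>(i, j)\<close> with steps
  \<open>(1, 1)\<close> in three colours, \<open>(2, 1)\<close> and \<open>(1, 2)\<close>.\<close>

fun path_poly :: "nat \<Rightarrow> 'a::comm_ring_1 poly" where
  "path_poly 0 = 1"
| "path_poly (Suc 0) = [:0, 3, 1:]"
| "path_poly (Suc (Suc j)) = [:0, 3, 1:] * path_poly (Suc j) + [:0, 1:] * path_poly j"

lemma coeff_path_poly_0: "coeff (path_poly j) 0 = (if j = 0 then 1 else 0)"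
  by (induction j rule: path_poly.induct) (simp_all add: coeff_mult)

text \<open>The linear span of \<open>g\<^sub>0, \<dots>, g\<^sub>n\<^sub>-\<^sub>1\<close>.\<close>

definition path_span :: "nat \<Rightarrow> 'a::field_char_0 poly set" where
  "path_span n = {\<Sum>j<n. smult (b j) (path_poly j) |b. True}"

lemma path_spanI: "(\<Sum>j<n. smult (b j) (path_poly j)) \<in> path_span n"
  by (auto simp: path_span_def)

lemma path_span_add: "p \<in> path_span n \<Longrightarrow> q \<in> path_span n \<Longrightarrow> p + q \<in> path_span n"
  using path_spanI[of "\<lambda>j. a j + b j" n for a b]
  by (auto simp: path_span_def smult_add_left sum.distrib)

lemma path_span_smult: "p \<in> path_span n \<Longrightarrow> smult c p \<in> path_span n"
proof -
  assume "p \<in> path_span n"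
  then obtain a where "p = (\<Sum>j<n. smult (a j) (path_poly j))"
    by (auto simp: path_span_def)
  then have "smult c p = (\<Sum>j<n. smult (c * a j) (path_poly j))"
    using sum_distrib_left[of "[:c:]" "\<lambda>j. smult (a j) (path_poly j)" "{..<n}"] by (simp add: mult.commute)
  then show ?thesis by (simp only: path_spanI)
qed

lemma path_poly_in_span: "j < n \<Longrightarrow> path_poly j \<in> path_span n"
proof -
  assume "j < n"
  then have "path_poly j = (\<Sum>i<n. smult (if i = j then 1 else 0 :: 'a) (path_poly i))"
    by (subst sum.remove[of _ j]) auto
  then show ?thesis using path_spanI[of "\<lambda>i. if i = j then 1 else 0" n] by simp
qed

lemma path_span_0: "0 \<in> path_span n"
  unfolding path_span_def by (auto intro!: exI[of _ "\<lambda>_. 0"])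

lemma path_span_sum: "(\<And>i. i \<in> A \<Longrightarrow> f i \<in> path_span n) \<Longrightarrow> sum f A \<in> path_span n"
  by (induction A rule: infinite_finite_induct) (auto intro: path_span_0 path_span_add)

lemma path_span_mono: "m \<le> n \<Longrightarrow> path_span m \<subseteq> path_span n"
proof
  fix p :: "'a poly"
  assume "m \<le> n" "p \<in> path_span m"
  then show "p \<in> path_span n"
    unfolding path_span_def[of m] by (auto intro!: path_span_sum path_span_smult path_poly_in_span)
qed

text \<open>Up to the factor \<open>T\<close>, the multiplication by \<open>(1 + T)^3\<close> acts on the \<open>g\<^sub>j\<close> with
  \<open>j > 0\<close> like the shift operator \<open>\<sigma> (1 + \<sigma>\<inverse>)^3\<close> on the index, with \<open>g\<^sub>-\<^sub>1 = 0\<close>. It fails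
  for \<open>j = 0\<close>, because the recurrence, continued backwards, gives \<open>g\<^sub>-\<^sub>2 = 1 / T\<close> rather than 0.\<close>

lemma cubic_mult_path_poly:
  "[:1, 1:] ^ 3 * path_poly (Suc j) = [:0, 1:] *
     (path_poly (Suc (Suc j)) + 3 * path_poly (Suc j) + 3 * path_poly j
      + (case j of 0 \<Rightarrow> 0 | Suc i \<Rightarrow> path_poly i))"
proof (cases j)
  case 0
  then show ?thesis by (simp add: eval_nat_numeral numeral_poly one_pCons)
next
  case (Suc i)
  define T :: "'a poly" where "T = [:0, 1:]"
  have T: "[:1, 1:] = 1 + T" "[:0, 3, 1:] = 3 * T + T ^ 2"
    by (simp_all add: T_def power2_eq_square one_pCons numeral_poly)
  have step: "path_poly (Suc (Suc l)) = (3 * T + T ^ 2) * path_poly (Suc l) + T * path_poly l" for l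
    by (simp only: path_poly.simps T T_def[symmetric])
  have "(1 + T) ^ 3 * p = T * (((3 * T + T ^ 2) * p + T * q) + 3 * p + 3 * q + r)"
    if "p = (3 * T + T ^ 2) * q + T * r" for p q r
    unfolding that by (simp add: algebra_simps power2_eq_square power3_eq_cube)
  from this[OF step[of i]] show ?thesis
    unfolding T(1) T_def[symmetric] Suc step[of "Suc i"] by (simp only: nat.case)
qed

text \<open>The divided difference \<open>(T p(T) - c p(c)) / (T - c)\<close>.\<close>

definition shift_quot :: "'a::field_char_0 \<Rightarrow> 'a poly \<Rightarrow> 'a poly" where
  "shift_quot c p = synthetic_div (pCons 0 p) c"

lemma shift_quot_correct: "pCons 0 p + smult c (shift_quot c p) = pCons (poly (pCons 0 p) c) (shift_quot c p)"
  unfolding shift_quot_def by (rule synthetic_div_correct)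

lemma shift_quot_unique: "pCons 0 p + smult c q = pCons r q \<Longrightarrow> shift_quot c p = q"
  unfolding shift_quot_def using synthetic_div_unique[of "pCons 0 p" c q r] by (simp only:)

lemma shift_quot_add: "shift_quot c (p + q) = shift_quot c p + shift_quot c q"
proof (rule shift_quot_unique)
  show "pCons 0 (p + q) + smult c (shift_quot c p + shift_quot c q) =
      pCons (poly (pCons 0 p) c + poly (pCons 0 q) c) (shift_quot c p + shift_quot c q)"
  proof -
    have "pCons 0 (p + q) + smult c (shift_quot c p + shift_quot c q) =
        (pCons 0 p + smult c (shift_quot c p)) + (pCons 0 q + smult c (shift_quot c q))"
      by (simp add: smult_add_right)
    then show ?thesis unfolding shift_quot_correct by simp
  qed
qed

lemma shift_quot_smult: "shift_quot c (smult a p) = smult a (shift_quot c p)"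
proof (rule shift_quot_unique)
  show "pCons 0 (smult a p) + smult c (smult a (shift_quot c p)) =
      pCons (a * poly (pCons 0 p) c) (smult a (shift_quot c p))"
    using arg_cong[OF shift_quot_correct[of p c], of "smult a"]
    by (simp add: smult_add_right mult.commute)
qed

lemma shift_quot_0_right: "shift_quot c 0 = 0"
  by (simp add: shift_quot_def)

lemma shift_quot_sum: "shift_quot c (sum f A) = (\<Sum>i\<in>A. shift_quot c (f i))"
  by (induction A rule: infinite_finite_induct) (simp_all add: shift_quot_add shift_quot_0_right)

lemma coeff_shift_quot: "coeff (shift_quot c p) i - c * coeff (shift_quot c p) (Suc i) = coeff p i"
  using arg_cong[OF shift_quot_correct[of p c], of "\<lambda>q. coeff q (Suc i)"]
  by (simp add: algebra_simps)

lemma coeff_shift_quot_monom: "coeff (shift_quot c (monom 1 n * p)) n = poly p c"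
  by (induction n) (simp_all add: monom_Suc shift_quot_def)

lemma shift_quot_0: "shift_quot 0 p = p"
  by (rule shift_quot_unique[of _ _ _ 0]) simp

section \<open>A generating function for the reduced Hankel matrix\<close>

lemma recurrence_gf:
  fixes h :: "nat \<Rightarrow> 'b::comm_ring_1"
  assumes "h 0 = 1" "h (Suc 0) = a" "\<And>j. h (Suc (Suc j)) = a * h (Suc j) + b * h j"
  shows "(1 - fps_const a * fps_X - fps_const b * fps_X ^ 2) * Abs_fps h = 1"
proof (rule fps_ext)
  fix m
  consider "m = 0" | "m = Suc 0" | j where "m = Suc (Suc j)"
    by (metis not0_implies_Suc)
  then show "fps_nth ((1 - fps_const a * fps_X - fps_const b * fps_X ^ 2) * Abs_fps h) m = fps_nth 1 m"
    by cases (simp_all add: left_diff_distrib mult.assoc fps_X_power_mult_nth assms)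
qed

text \<open>Bivariate power series are represented by the type \<^typ>\<open>'a fps fps\<close>: the outer variable is
  \<open>Q\<close>, and \<open>T\<close> is the inner one, that is, \<^term>\<open>fps_const fps_X\<close>. The coefficient of
  \<open>T^i Q^j\<close> in \<open>F\<close> is therefore \<^term>\<open>fps_nth (fps_nth F j) i\<close>. A series in \<open>T\<close> alone is
  embedded by \<^const>\<open>fps_const\<close>, and one in \<open>Q\<close> alone by the following function.\<close>

definition fps_lift :: "'a::comm_ring_1 fps \<Rightarrow> 'a fps fps" where
  "fps_lift f = Abs_fps (\<lambda>j. fps_const (fps_nth f j))"

lemma fps_lift_nth [simp]: "fps_nth (fps_lift f) j = fps_const (fps_nth f j)"
  by (simp add: fps_lift_def)

lemma fps_const_sum_eq: "fps_const (sum f A) = (\<Sum>x\<in>A. fps_const (f x))"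
  by (induction A rule: infinite_finite_induct) (simp_all add: fps_const_add[symmetric] del: fps_const_add)

lemma fps_lift_mult: "fps_lift (f * g) = fps_lift f * fps_lift g"
  by (rule fps_ext) (simp add: fps_mult_nth fps_const_sum_eq)

lemma fps_lift_add: "fps_lift (f + g) = fps_lift f + fps_lift g"
  by (rule fps_ext) simp

lemma fps_lift_diff: "fps_lift (f - g) = fps_lift f - fps_lift g"
  by (rule fps_ext) simp

lemma fps_lift_1 [simp]: "fps_lift 1 = 1"
  by (rule fps_ext) simp

lemma fps_lift_X [simp]: "fps_lift fps_X = fps_X"
  by (rule fps_ext) simp

lemma fps_lift_const [simp]: "fps_lift (fps_const a) = fps_const (fps_const a)"
  by (rule fps_ext) simp

lemma fps_lift_numeral [simp]: "fps_lift (numeral w) = numeral w"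
  by (rule fps_ext) (simp add: fps_numeral_fps_const)

lemma fps_lift_power: "fps_lift (f ^ k) = fps_lift f ^ k"
  by (induction k) (simp_all add: fps_lift_mult)

lemmas fps_lift_simps = fps_lift_mult fps_lift_add fps_lift_diff fps_lift_power

lemma fps_const_lift_nth: "fps_nth (fps_nth (fps_const f * fps_lift g) j) i = fps_nth g j * fps_nth f i"
  by (simp add: mult.commute)

text \<open>The series \<open>D(c, Q)\<close> in \<open>Q\<close>.\<close>

definition quot_denom :: "'a::field_char_0 \<Rightarrow> 'a fps" where
  "quot_denom c = 1 - fps_const (3 * c + c ^ 2) * fps_X - fps_const c * fps_X ^ 2"

text \<open>The generating function, with respect to \<open>Q\<close>, of the divided differences of the
  \<open>T g\<^sub>j(T)\<close> at \<open>c\<close>.\<close>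

definition quot_gf :: "'a::field_char_0 \<Rightarrow> 'a fps fps" where
  "quot_gf c = Abs_fps (\<lambda>j. fps_of_poly (shift_quot c (path_poly j)))"

text \<open>The series \<open>D(T, Q)\<close>.\<close>

definition path_denom :: "'a::field_char_0 fps fps" where
  "path_denom = 1 - fps_const (3 * fps_X + fps_X ^ 2) * fps_X - fps_const fps_X * fps_X ^ 2"

text \<open>Both sides agree after multiplication by \<open>T - c\<close>, which is not a zero divisor.\<close>

lemma quot_gf_eq:
  fixes c :: "'a::field_char_0"
  shows "path_denom * (fps_lift (quot_denom c) * quot_gf c) = 1 + fps_const (fps_const c) * fps_const fps_X * fps_X"
proof -
  define T C :: "'a fps fps" where "T = fps_const fps_X" and "C = fps_const (fps_const c)"
  define P :: "'a fps fps" where "P = Abs_fps (\<lambda>j. fps_of_poly (path_poly j))"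
  define E :: "'a fps" where "E = Abs_fps (\<lambda>j. poly (path_poly j) c)"
  have "fps_of_poly [:0, 3, 1:] = 3 * fps_X + (fps_X ^ 2 :: 'a fps)"
    by (simp add: fps_of_poly_pCons power2_eq_square algebra_simps numeral_fps_const)
  then have P: "path_denom * P = 1"
    unfolding path_denom_def P_def
    by (intro recurrence_gf) (simp_all add: fps_of_poly_mult fps_of_poly_add del: pCons_eq_iff mult_pCons_left)
  have E: "quot_denom c * E = 1"
    unfolding quot_denom_def E_def
    by (intro recurrence_gf) (simp_all add: algebra_simps power2_eq_square)
  have quot: "T * quot_gf c - C * quot_gf c = T * P - C * fps_lift E"
  proof (rule fps_ext)
    fix j
    have "fps_of_poly (pCons 0 (path_poly j) + smult c (shift_quot c (path_poly j))) =
        fps_of_poly (pCons (poly (pCons 0 (path_poly j)) c) (shift_quot c (path_poly j)))"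
      by (simp only: shift_quot_correct)
    then show "fps_nth (T * quot_gf c - C * quot_gf c) j = fps_nth (T * P - C * fps_lift E) j"
      by (simp add: T_def C_def P_def E_def quot_gf_def fps_of_poly_add fps_of_poly_pCons fps_of_poly_smult
          algebra_simps)
  qed
  have TC: "T - C \<noteq> 0"
  proof
    assume "T - C = 0"
    then have "fps_nth (fps_nth (T - C) 0) 1 = 0" by simp
    then show False by (simp add: T_def C_def)
  qed
  have u: "fps_lift (quot_denom c) = 1 - (3 * C + C ^ 2) * fps_X - C * fps_X ^ 2"
    by (simp add: quot_denom_def fps_lift_simps C_def fps_const_add[symmetric] fps_const_mult[symmetric]
          fps_const_power[symmetric] numeral_fps_const del: fps_const_add fps_const_mult fps_const_power)
  have d: "path_denom = 1 - (3 * T + T ^ 2) * fps_X - T * fps_X ^ 2"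
    by (simp add: path_denom_def T_def fps_const_add[symmetric] fps_const_mult[symmetric]
          fps_const_power[symmetric] numeral_fps_const del: fps_const_add fps_const_mult fps_const_power)
  have "(T - C) * (path_denom * (fps_lift (quot_denom c) * quot_gf c)) =
      path_denom * fps_lift (quot_denom c) * (T * quot_gf c - C * quot_gf c)"
    by (simp only: ring_distribs mult_ac)
  also have "\<dots> = T * fps_lift (quot_denom c) * (path_denom * P) - C * path_denom * fps_lift (quot_denom c * E)"
    unfolding quot fps_lift_mult by (simp only: ring_distribs mult_ac)
  also have "\<dots> = T * fps_lift (quot_denom c) - C * path_denom"
    by (simp add: P E)
  also have "\<dots> = (T - C) * (1 + C * T * fps_X)"
    unfolding u d by (simp add: algebra_simps power2_eq_square)
  finally show ?thesis using TC unfolding T_def[symmetric] C_def[symmetric] by simp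
qed

text \<open>The series \<open>\<omega>\<^sub>k(T)\<close>.\<close>

definition row_weight :: "'a::field_char_0 \<Rightarrow> nat \<Rightarrow> 'a fps" where
  "row_weight s k = (1 + fps_X) ^ (3 * k + 2) * inverse (1 - fps_const s * fps_X)"

lemma row_weight_mult: "(1 - fps_const s * fps_X) * row_weight s k = (1 + fps_X) ^ (3 * k + 2)"
proof -
  have "inverse (1 - fps_const s * fps_X) * (1 - fps_const s * fps_X) = 1"
    by (rule inverse_mult_eq_1) simp
  then show ?thesis by (simp add: row_weight_def mult_ac)
qed

lemma row_weight_Suc: "row_weight s (Suc k) = (1 + fps_X) ^ 3 * row_weight s k"
  by (simp add: row_weight_def power_add eval_nat_numeral mult_ac)

lemma fps_one_plus_X_power_nth: "fps_nth ((1 + fps_X) ^ m) k = (of_nat (m choose k) :: 'a::field_char_0)"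
  using fps_binomial_of_nat[of m, where 'a = 'a] by (metis fps_binomial_nth binomial_gbinomial)

lemma row_weight_nth_0: "fps_nth (row_weight s k) 0 = 1"
  by (simp add: row_weight_def fps_one_plus_X_power_nth del: power_Suc power_add)

text \<open>Expand \<open>\<omega>\<^sub>k(T) = (1 + T)^(3k+2) / ((1 + T) - x T)\<close> as a geometric series in
  \<open>x T / (1 + T)\<close>; the terms beyond the \<open>k\<close>-th do not contribute to the coefficient of \<open>T^k\<close>.\<close>

lemma hankel_coeff_eq: "hankel_coeff k x = fps_nth (row_weight (x - 1) k) (k :: nat)"
proof -
  define S where "S = (\<Sum>m\<le>k. (fps_const x * fps_X) ^ m * (1 + fps_X) ^ (3 * k + 1 - m) :: 'a fps)"
  define y :: "'a fps" where "y = fps_const x * fps_X"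
  define z :: "'a fps" where "z = 1 + fps_X"
  have *: "(z - y) * (\<Sum>m\<le>j. y ^ m * z ^ (3 * k + 1 - m)) = z ^ (3 * k + 2) - y ^ Suc j * z ^ (3 * k + 1 - j)"
    if "j \<le> k" for j
    using that
  proof (induction j)
    case 0
    show ?case by (simp add: algebra_simps)
  next
    case (Suc j)
    have "3 * k + 1 - j = Suc (3 * k + 1 - Suc j)" using Suc.prems by linarith
    with Suc show ?case by (simp add: algebra_simps)
  qed
  have zy: "z - y = 1 - fps_const (x - 1) * fps_X"
    by (simp add: z_def y_def fps_const_sub[symmetric] algebra_simps del: fps_const_sub)
  define r where "r = inverse (z - y)"
  have r: "r * (z - y) = 1"
    unfolding r_def zy by (rule inverse_mult_eq_1) simp
  have "row_weight (x - 1) k = r * z ^ (3 * k + 2)"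
    unfolding row_weight_def r_def zy unfolding z_def by (simp only: mult.commute)
  also have "\<dots> = r * ((z - y) * S + y ^ Suc k * z ^ (3 * k + 1 - k))"
    using *[OF order_refl] by (simp only: S_def y_def z_def diff_add_cancel)
  also have "\<dots> = r * (z - y) * S + r * (y ^ Suc k * z ^ (3 * k + 1 - k))"
    by (simp only: distrib_left mult.assoc)
  finally have row: "row_weight (x - 1) k = S + fps_X ^ Suc k * (fps_const x ^ Suc k * (r * z ^ (3 * k + 1 - k)))"
    unfolding r by (simp add: y_def power_mult_distrib mult_ac)
  have "fps_nth (row_weight (x - 1) k) k = fps_nth S k"
    unfolding row by (simp add: fps_X_power_mult_nth del: power_Suc)
  also have "\<dots> = (\<Sum>m\<le>k. x ^ m * of_nat ((3 * k + 1 - m) choose (k - m)))"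
    unfolding S_def
    by (simp add: fps_sum_nth power_mult_distrib mult.assoc fps_const_power fps_X_power_mult_nth fps_one_plus_X_power_nth)
  also have "\<dots> = hankel_coeff k x"
    by (simp add: hankel_coeff_def atLeast0AtMost mult.commute)
  finally show ?thesis ..
qed

text \<open>The series \<open>\<omega>\<^sub>i(T) \<omega>\<^sub>j(Q) (1 + c T Q) / D(T, Q)\<close> with \<open>c = -2 s\<close>. The last factor is
  written as the product of \<open>D(c, Q)\<close> with the generating function of the divided differences.\<close>

definition hankel_gf :: "'a::field_char_0 \<Rightarrow> nat \<Rightarrow> nat \<Rightarrow> 'a fps fps" where
  "hankel_gf s i j = fps_const (row_weight s i) *
     (fps_lift (row_weight s j * quot_denom (- 2 * s)) * quot_gf (- 2 * s))"

text \<open>This vanishing is special to the exponent \<open>3 k + 2\<close>: the binomial coefficients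
  \<open>3k+2\<close> over \<open>k+1\<close> and \<open>3k+2\<close> over \<open>k\<close> have the ratio 2.\<close>

lemma row_weight_coeff_0: "fps_nth ((1 - 2 * fps_X) * (1 + fps_X) ^ (3 * k + 2)) (Suc k) = (0 :: 'a::field_char_0)"
proof -
  have "Suc k * (3 * k + 2 choose Suc k) = Suc k * (2 * (3 * k + 2 choose k))"
    using binomial_absorption[of k "3 * k + 2"] binomial_absorb_comp[of "3 * k + 2" k]
    by (simp del: binomial_Suc_Suc)
  then have "of_nat (3 * k + 2 choose Suc k) = (2 * of_nat (3 * k + 2 choose k) :: 'a)"
    by (metis mult_left_cancel nat.simps(3) of_nat_mult of_nat_numeral)
  then show ?thesis
    by (simp add: left_diff_distrib mult.assoc fps_one_plus_X_power_nth numeral_fps_const del: power_Suc)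
qed

text \<open>The difference of the two sides is a coefficient of
  \<open>(T (1 + Q)^3 - Q (1 + T)^3) \<omega>\<^sub>i(T) \<omega>\<^sub>j(Q) (1 + c T Q) / D(T, Q)
    = (T - Q) (1 - 2 s T Q) \<omega>\<^sub>i(T) \<omega>\<^sub>j(Q)\<close>. As
  \<open>(T - Q) (1 - 2 s T Q) = T (1 - s Q) (1 - 2 Q) - Q (1 - s T) (1 - 2 T)\<close>, it is a sum of two
  products of univariate series, each with a vanishing coefficient.\<close>

lemma hankel_gf_shift:
  "fps_nth (fps_nth (hankel_gf s (Suc i) j) j) (Suc i) = fps_nth (fps_nth (hankel_gf s i (Suc j)) (Suc j)) i"
proof -
  define T S Q :: "'a fps fps" where "T = fps_const fps_X" and "S = fps_const (fps_const s)" and "Q = fps_X"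
  define F where "F = hankel_gf s i j"
  define f g where "f = fps_const (row_weight s i)" and "g = fps_lift (row_weight s j)"
  have T1: "fps_const (1 + fps_X) = 1 + T" by (simp add: T_def fps_const_add[symmetric] del: fps_const_add)
  have rowT: "(1 - S * T) * f = (1 + T) ^ (3 * i + 2)"
  proof -
    have "(1 - S * T) * f = fps_const ((1 - fps_const s * fps_X) * row_weight s i)"
      by (simp add: S_def T_def f_def fps_const_sub[symmetric] fps_const_mult[symmetric] del: fps_const_sub fps_const_mult)
    also have "\<dots> = (1 + T) ^ (3 * i + 2)"
      unfolding row_weight_mult T1[symmetric] by (simp only: fps_const_power)
    finally show ?thesis .
  qed
  have rowQ: "(1 - S * Q) * g = (1 + Q) ^ (3 * j + 2)"
  proof -
    have "(1 - S * Q) * g = fps_lift ((1 - fps_const s * fps_X) * row_weight s j)"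
      by (simp add: S_def Q_def g_def fps_lift_simps)
    then show ?thesis
      unfolding row_weight_mult by (simp add: fps_lift_simps Q_def)
  qed
  have D: "path_denom = 1 - (3 * T + T ^ 2) * Q - T * Q ^ 2"
    by (simp add: path_denom_def T_def Q_def fps_const_add[symmetric] fps_const_mult[symmetric]
          fps_const_power[symmetric] numeral_fps_const del: fps_const_add fps_const_mult fps_const_power)
  have "hankel_gf s (Suc i) j = (1 + T) ^ 3 * F"
    unfolding F_def hankel_gf_def row_weight_Suc T1[symmetric] fps_const_power fps_const_mult[symmetric]
    by (simp only: mult.assoc)
  moreover have "hankel_gf s i (Suc j) = (1 + Q) ^ 3 * F"
    unfolding F_def hankel_gf_def row_weight_Suc fps_lift_simps Q_def by (simp add: mult_ac)
  moreover have "path_denom * F = f * g * (1 - 2 * S * T * Q)"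
  proof -
    have "path_denom * F = f * g * (path_denom * (fps_lift (quot_denom (- 2 * s)) * quot_gf (- 2 * s)))"
      unfolding F_def hankel_gf_def f_def g_def fps_lift_mult by (simp only: mult_ac)
    also have "\<dots> = f * g * (1 - 2 * S * T * Q)"
      unfolding quot_gf_eq
      by (simp add: S_def T_def Q_def numeral_fps_const fps_const_neg[symmetric] fps_const_mult[symmetric]
          del: fps_const_neg fps_const_mult)
    finally show ?thesis .
  qed
  moreover have "T * ((1 + Q) ^ 3 * F) - Q * ((1 + T) ^ 3 * F) = (T - Q) * (path_denom * F)"
    unfolding D by (simp add: algebra_simps power2_eq_square power3_eq_cube)
  ultimately have "T * hankel_gf s i (Suc j) - Q * hankel_gf s (Suc i) j = (T - Q) * (f * g * (1 - 2 * S * T * Q))"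
    by simp
  also have "\<dots> = T * f * ((1 - 2 * Q) * ((1 - S * Q) * g)) - (1 - 2 * T) * ((1 - S * T) * f) * (Q * g)"
    by (simp add: algebra_simps)
  also have "\<dots> = fps_const (fps_X * row_weight s i) * fps_lift ((1 - 2 * fps_X) * (1 + fps_X) ^ (3 * j + 2))
      - fps_const ((1 - 2 * fps_X) * (1 + fps_X) ^ (3 * i + 2)) * fps_lift (fps_X * row_weight s j)"
  proof -
    have "(1 - 2 * T) * (1 + T) ^ (3 * i + 2) = fps_const ((1 - 2 * fps_X) * (1 + fps_X) ^ (3 * i + 2))"
      unfolding fps_const_mult[symmetric] fps_const_power[symmetric] T1
      by (simp add: T_def fps_const_sub[symmetric] fps_const_mult[symmetric] numeral_fps_const
          del: fps_const_sub fps_const_mult)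
    moreover have "(1 - 2 * Q) * (1 + Q) ^ (3 * j + 2) = fps_lift ((1 - 2 * fps_X) * (1 + fps_X) ^ (3 * j + 2))"
      by (simp add: fps_lift_simps Q_def)
    ultimately show ?thesis unfolding rowT rowQ
      by (simp add: f_def g_def T_def Q_def fps_lift_simps)
  qed
  finally have "fps_nth (fps_nth (T * hankel_gf s i (Suc j) - Q * hankel_gf s (Suc i) j) (Suc j)) (Suc i) = 0"
    by (simp only: fps_sub_nth fps_const_lift_nth row_weight_coeff_0 mult_zero_left mult_zero_right diff_self)
  then show ?thesis
    by (simp add: T_def Q_def)
qed

lemma hankel_gf_nth: "fps_nth (fps_nth (hankel_gf s i j) j) i = fps_nth (row_weight s (i + j)) (i + j)"
proof (induction j arbitrary: i)
  case 0
  have "fps_nth (fps_lift (row_weight s 0 * quot_denom (- 2 * s)) * quot_gf (- 2 * s)) 0 = 1"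
    by (simp add: row_weight_nth_0 quot_denom_def quot_gf_def shift_quot_def one_pCons)
  then show ?case by (simp add: hankel_gf_def)
next
  case (Suc j)
  have "fps_nth (fps_nth (hankel_gf s i (Suc j)) (Suc j)) i = fps_nth (fps_nth (hankel_gf s (Suc i) j) j) (Suc i)"
    by (rule hankel_gf_shift[symmetric])
  then show ?case by (simp add: Suc.IH)
qed

text \<open>The Hankel matrix as a product of a lower triangular matrix, the matrix of the coefficients
  of the divided differences, and an upper triangular matrix.\<close>

lemma hankel_coeff_expand:
  "hankel_coeff (i + j) x = (\<Sum>b\<le>j. (\<Sum>a\<le>i. fps_nth (row_weight (x - 1) i) (i - a) * coeff (shift_quot (- 2 * (x - 1)) (path_poly b)) a)
       * fps_nth (row_weight (x - 1) j * quot_denom (- 2 * (x - 1))) (j - b))"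
proof -
  define s where "s = x - 1"
  have conv: "fps_nth (f * g) n = (\<Sum>k\<le>n. fps_nth f (n - k) * fps_nth g k)" for f g :: "'b::comm_ring_1 fps" and n
    unfolding mult.commute[of f g] fps_mult_nth atLeast0AtMost by (simp only: mult.commute)
  have "hankel_coeff (i + j) x = fps_nth (fps_nth (hankel_gf s i j) j) i"
    by (simp add: hankel_gf_nth hankel_coeff_eq s_def)
  also have "hankel_gf s i j = fps_lift (row_weight s j * quot_denom (- 2 * s)) * (fps_const (row_weight s i) * quot_gf (- 2 * s))"
    by (simp only: hankel_gf_def mult_ac)
  also have "fps_nth (fps_nth \<dots> j) i = (\<Sum>b\<le>j. fps_nth (row_weight s j * quot_denom (- 2 * s)) (j - b) *
       fps_nth (row_weight s i * fps_of_poly (shift_quot (- 2 * s) (path_poly b))) i)"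
    by (subst conv) (simp add: fps_sum_nth quot_gf_def)
  also have "\<dots> = (\<Sum>b\<le>j. (\<Sum>a\<le>i. fps_nth (row_weight s i) (i - a) * coeff (shift_quot (- 2 * s) (path_poly b)) a)
       * fps_nth (row_weight s j * quot_denom (- 2 * s)) (j - b))"
    unfolding conv[of "row_weight s i"] by (simp add: mult.commute)
  finally show ?thesis by (simp add: s_def)
qed

lemma det_mat_mult:
  fixes f g :: "nat \<Rightarrow> nat \<Rightarrow> 'b::comm_ring_1"
  shows "det (mat N N (\<lambda>(i, j). \<Sum>k<N. f i k * g k j)) =
    det (mat N N (\<lambda>(i, j). f i j)) * det (mat N N (\<lambda>(i, j). g i j))"
proof -
  have "mat N N (\<lambda>(i, j). \<Sum>k<N. f i k * g k j) = mat N N (\<lambda>(i, j). f i j) * mat N N (\<lambda>(i, j). g i j)"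
    by (rule eq_matI) (auto simp: scalar_prod_def atLeast0LessThan)
  then show ?thesis by (simp add: det_mult[of _ N])
qed

lemma det_unit_lower_triangular:
  fixes f :: "nat \<Rightarrow> nat \<Rightarrow> 'b::comm_ring_1"
  assumes "\<And>i j. i < j \<Longrightarrow> f i j = 0" "\<And>i. i < N \<Longrightarrow> f i i = 1"
  shows "det (mat N N (\<lambda>(i, j). f i j)) = 1"
  by (subst det_lower_triangular[of N]) (auto simp: assms prod_list_diag_prod)

lemma det_unit_upper_triangular:
  fixes f :: "nat \<Rightarrow> nat \<Rightarrow> 'b::comm_ring_1"
  assumes "\<And>i j. j < i \<Longrightarrow> f i j = 0" "\<And>i. i < N \<Longrightarrow> f i i = 1"
  shows "det (mat N N (\<lambda>(i, j). f i j)) = 1"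
  by (subst det_upper_triangular[of _ N]) (auto simp: assms prod_list_diag_prod)

lemma hankel_det_eq_det_shift_quot:
  fixes x :: "'a::field_char_0"
  shows "hankel_det n x = det (mat (Suc n) (Suc n) (\<lambda>(i, j). coeff (shift_quot (- 2 * (x - 1)) (path_poly j)) i))"
proof -
  define c where "c = - 2 * (x - 1)"
  define p where "p i a = (if a \<le> i then fps_nth (row_weight (x - 1) i) (i - a) else 0)" for i a
  define w where "w b j = (if b \<le> j then fps_nth (row_weight (x - 1) j * quot_denom c) (j - b) else 0)" for b j
  have trunc: "(\<Sum>a\<le>i. h a) = (\<Sum>a<Suc n. if a \<le> i then h a else 0)" if "i \<le> n" for i and h :: "nat \<Rightarrow> 'a"
    using that by (intro sum.mono_neutral_cong_left) auto
  have "hankel_coeff (i + j) x = (\<Sum>b<Suc n. (\<Sum>a<Suc n. p i a * coeff (shift_quot c (path_poly b)) a) * w b j)"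
    if "i \<le> n" "j \<le> n" for i j
    unfolding hankel_coeff_expand c_def[symmetric] trunc[OF that(1)] trunc[OF that(2)] p_def w_def
    by (intro sum.cong refl) (auto intro!: arg_cong2[where f = "(*)"] sum.cong)
  then have "hankel_det n x = det (mat (Suc n) (Suc n)
      (\<lambda>(i, j). \<Sum>b<Suc n. (\<Sum>a<Suc n. p i a * coeff (shift_quot c (path_poly b)) a) * w b j))"
    unfolding hankel_det_def by (intro arg_cong[where f = det] eq_matI) (auto simp: less_Suc_eq_le)
  also have "\<dots> = det (mat (Suc n) (Suc n) (\<lambda>(i, j). p i j))
       * det (mat (Suc n) (Suc n) (\<lambda>(i, j). coeff (shift_quot c (path_poly j)) i))
       * det (mat (Suc n) (Suc n) (\<lambda>(i, j). w i j))"
    unfolding det_mat_mult[where g = w] det_mat_mult[where f = p] ..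
  also have "det (mat (Suc n) (Suc n) (\<lambda>(i, j). p i j)) = 1"
    by (rule det_unit_lower_triangular) (auto simp: p_def row_weight_nth_0)
  also have "det (mat (Suc n) (Suc n) (\<lambda>(i, j). w i j)) = 1"
    by (rule det_unit_upper_triangular) (auto simp: w_def row_weight_nth_0 quot_denom_def)
  finally show ?thesis by (simp add: c_def)
qed

section \<open>The hypergeometric polynomials\<close>

text \<open>The coefficients of the monic multiple of
  \<open>\<^sub>2F\<^sub>1(-n, 3n+3; 2n+5/2; -T/4)\<close>, which is proportional to the Jacobi polynomial
  with parameters \<open>(2n+3/2, 1/2)\<close> at \<open>1 + T/2\<close>.\<close>

definition jacobi_coeff :: "nat \<Rightarrow> nat \<Rightarrow> 'a::field_char_0" where
  "jacobi_coeff n i = (if i \<le> n then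
     fact n * fact (3 * n + 2 + i) * fact (2 * n + i + 1) * fact (6 * n + 3) /
     (fact i * fact (n - i) * fact (4 * n + 2) * fact (3 * n + 1) * fact (4 * n + 2 * i + 3)) else 0)"

definition jacobi_poly :: "nat \<Rightarrow> 'a::field_char_0 poly" where
  "jacobi_poly n = (\<Sum>i\<le>n. monom (jacobi_coeff n i) i)"

lemma coeff_jacobi: "coeff (jacobi_poly n) i = jacobi_coeff n i"
  by (auto simp: jacobi_poly_def coeff_sum jacobi_coeff_def sum.delta)

text \<open>Up to a power of 2 this is \<open>1 / (2 k + 1)!!\<close>. It collects the double factorials in the
  coefficients, and the ratio of two consecutive values is a polynomial in \<open>k\<close>.\<close>

definition semifact :: "nat \<Rightarrow> 'a::field_char_0" where
  "semifact k = fact k / fact (2 * k + 1)"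

lemma semifact_Suc: "semifact k = 2 * (2 * of_nat k + 3) * semifact (Suc k)"
proof -
  have 1: "fact (2 * Suc k + 1) = (2 * of_nat k + 3) * (2 * (1 + of_nat k)) * (fact (2 * k + 1) :: 'a)"
    by (simp add: algebra_simps)
  have 2: "fact (Suc k) = (1 + of_nat k) * (fact k :: 'a)" by simp
  have "of_nat (Suc k) \<noteq> (0::'a)" "of_nat (2 * k + 3) \<noteq> (0::'a)"
    by (simp_all only: of_nat_eq_0_iff)
  then have nz: "1 + of_nat k \<noteq> (0::'a)" "2 * of_nat k + 3 \<noteq> (0::'a)" by simp_all
  have cancel: "a / F = 2 * b * (c * a / (b * (2 * c) * F))" if "b \<noteq> 0" "c \<noteq> 0" "F \<noteq> 0" for a b c F :: 'a
    using that by (simp add: field_simps)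
  show ?thesis
    unfolding semifact_def 1 2
    using cancel[where b = "2 * of_nat k + 3" and c = "1 + of_nat k" and F = "fact (2 * k + 1)", OF nz(2,1) fact_nonzero] nz by simp
qed

text \<open>The part of \<^const>\<open>jacobi_coeff\<close> that depends on \<open>n\<close> only.\<close>

definition jacobi_scale :: "nat \<Rightarrow> 'a::field_char_0" where
  "jacobi_scale n = fact n * fact (6 * n + 3) / (fact (4 * n + 2) * fact (3 * n + 1))"

lemma jacobi_coeff_alt:
  "i \<le> n \<Longrightarrow> jacobi_coeff n i =
     jacobi_scale n * (fact (3 * n + 2 + i) * semifact (2 * n + i + 1) / (fact i * fact (n - i)))"
proof -
  have 1: "2 * (2 * n + i + 1) + 1 = 4 * n + 2 * i + 3" by simp
  show "i \<le> n \<Longrightarrow> ?thesis"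
    unfolding jacobi_coeff_def jacobi_scale_def semifact_def 1
    by (simp only: if_True times_divide_times_eq times_divide_eq_left times_divide_eq_right
          divide_divide_eq_left mult_ac)
qed

lemma fact_add3: "fact (m + 3) = (of_nat m + 3) * (of_nat m + 2) * (of_nat m + 1) * (fact m :: 'a::field_char_0)"
  by (simp add: numeral_3_eq_3 algebra_simps)

lemma of_nat_plus_neq_0 [simp]:
  "of_nat m + 1 \<noteq> (0::'a::field_char_0)"  "of_nat m + numeral w \<noteq> (0::'a::field_char_0)"
  "1 + of_nat m \<noteq> (0::'a::field_char_0)"  "numeral w + of_nat m \<noteq> (0::'a::field_char_0)"
proof -
  have "of_nat (m + 1) \<noteq> (0::'a)" "of_nat (m + numeral w) \<noteq> (0::'a)"
    by (simp_all only: of_nat_eq_0_iff) auto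
  then show "of_nat m + 1 \<noteq> (0::'a)"  "of_nat m + numeral w \<noteq> (0::'a)"
    "1 + of_nat m \<noteq> (0::'a)"  "numeral w + of_nat m \<noteq> (0::'a)"
    by (simp_all add: add.commute)
qed

text \<open>A common divisor of the coefficients in the three-term recurrence: up to factors that depend on
  \<open>n\<close> only, each of them is a polynomial in \<open>n\<close> and \<open>i\<close> times this term. The polynomials vanish
  whenever the index of the coefficient is out of range, so that no boundary cases remain for
  \<open>i \<le> n + 3\<close>.\<close>

definition jacobi_base :: "nat \<Rightarrow> nat \<Rightarrow> 'a::field_char_0" where
  "jacobi_base n i = fact (3 * n + i - 1) * semifact (2 * n + i + 1) / (fact i * fact (n + 3 - i))"

lemma jacobi_coeff_base0:
  fixes n i :: nat
  defines "N \<equiv> of_nat n" and "I \<equiv> of_nat i"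
  assumes "1 \<le> n" and "i \<le> n + 3"
  shows "jacobi_coeff n i = jacobi_scale n * ((3*N+I+2) * (3*N+I+1) * (3*N+I) * (N+3-I) * (N+2-I) * (N+1-I))
           * (jacobi_base n i :: 'a::field_char_0)"
proof (cases "i \<le> n")
  case True
  then obtain d where d: "n = i + d" by (auto simp: le_iff_add)
  have 1: "fact (3 * n + 2 + i) = (3*N+I+2) * (3*N+I+1) * (3*N+I) * (fact (3 * n + i - 1) :: 'a)"
    using fact_add3[of "3 * n + i - 1", where 'a = 'a] assms(3)
    by (simp add: N_def I_def of_nat_diff algebra_simps)
  have 2: "fact (n + 3 - i) = (N+3-I) * (N+2-I) * (N+1-I) * (fact (n - i) :: 'a)"
    using fact_add3[of d, where 'a = 'a] by (simp add: N_def I_def d algebra_simps)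
  have 3: "(N+3-I) * (N+2-I) * (N+1-I) \<noteq> 0"
    by (simp add: N_def I_def d)
  show ?thesis
    unfolding jacobi_coeff_alt[OF True] jacobi_base_def 1 2 using 3 by (simp add: divide_simps)
next
  case False
  then consider "i = n + 1" | "i = n + 2" | "i = n + 3" using assms by linarith
  then show ?thesis by cases (auto simp: jacobi_coeff_def N_def I_def)
qed

lemma jacobi_coeff_base1:
  fixes n i :: nat
  defines "N \<equiv> of_nat n" and "I \<equiv> of_nat i"
  assumes "1 \<le> n" and "i \<le> n + 3"
  shows "(if i < 1 then 0 else jacobi_coeff n (i - 1)) =
      jacobi_scale n * ((3*N+I+1) * (3*N+I) * I * (N+3-I) * (N+2-I) * (2 * (4*N+2*I+3)))
           * (jacobi_base n i :: 'a::field_char_0)"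
proof (cases "1 \<le> i \<and> i \<le> n + 1")
  case True
  define j where "j = i - 1"
  define d where "d = n - j"
  have d: "n = j + d" "i = Suc j" using True by (auto simp: j_def d_def)
  have 1: "fact (3 * n + 2 + j) = (3*N+I+1) * (3*N+I) * (fact (3 * n + i - 1) :: 'a)"
    using d by (simp add: N_def I_def algebra_simps)
  have 2: "fact (n + 3 - i) = (N+3-I) * (N+2-I) * (fact (n - j) :: 'a)"
    using d by (simp add: N_def I_def numeral_2_eq_2 algebra_simps)
  have 3: "(N+3-I) * (N+2-I) \<noteq> 0"
    by (simp add: N_def I_def d)
  have 4: "semifact (2 * n + j + 1) = 2 * (4*N+2*I+3) * (semifact (2 * n + i + 1) :: 'a)"
    using semifact_Suc[of "2 * n + j + 1", where 'a = 'a] d by (simp add: N_def I_def algebra_simps)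
  have 5: "fact i = I * (fact j :: 'a)" "I \<noteq> 0" using d by (simp_all add: I_def)
  have 6: "j \<le> n" "i - 1 = j" using d by auto
  show ?thesis
    using d(2) unfolding 6(2) jacobi_coeff_alt[OF 6(1)] jacobi_base_def 1 2 4 5(1) using 3 5(2)
    by (simp add: divide_simps)
next
  case False
  then consider "i = 0" | "i = n + 2" | "i = n + 3" using assms by linarith
  then show ?thesis by cases (auto simp: jacobi_coeff_def N_def I_def)
qed

lemma jacobi_coeff_base2:
  fixes n i :: nat
  defines "N \<equiv> of_nat n" and "I \<equiv> of_nat i"
  assumes "1 \<le> n" and "i \<le> n + 3"
  shows "(if i < 2 then 0 else jacobi_coeff n (i - 2)) =
      jacobi_scale n * ((3*N+I) * I * (I-1) * (N+3-I) * (4 * (4*N+2*I+3) * (4*N+2*I+1)))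
           * (jacobi_base n i :: 'a::field_char_0)"
proof (cases "2 \<le> i \<and> i \<le> n + 2")
  case True
  define j where "j = i - 2"
  define d where "d = n - j"
  have d: "n = j + d" "i = Suc (Suc j)" using True by (auto simp: j_def d_def)
  have 1: "fact (3 * n + 2 + j) = (3*N+I) * (fact (3 * n + i - 1) :: 'a)"
    using d by (simp add: N_def I_def algebra_simps)
  have 2: "fact (n + 3 - i) = (N+3-I) * (fact (n - j) :: 'a)"
    using d by (simp add: N_def I_def algebra_simps)
  have 3: "(N+3-I) \<noteq> 0"
    by (simp add: N_def I_def d)
  have 4: "semifact (2 * n + j + 1) = 4 * (4*N+2*I+3) * (4*N+2*I+1) * (semifact (2 * n + i + 1) :: 'a)"
    using semifact_Suc[of "2 * n + j + 1", where 'a = 'a] semifact_Suc[of "2 * n + j + 2", where 'a = 'a]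
     d by (simp add: N_def I_def algebra_simps)
  have 5: "fact i = I * (I-1) * (fact j :: 'a)" "I \<noteq> 0" "I - 1 \<noteq> 0" using d by (simp_all add: I_def)
  have 6: "j \<le> n" "i - 2 = j" using d by auto
  show ?thesis
    using d(2) unfolding 6(2) jacobi_coeff_alt[OF 6(1)] jacobi_base_def 1 2 4 5(1) using 3 5(2-)
    by (simp add: divide_simps)
next
  case False
  then consider "i = 0" | "i = 1" | "i = n + 3" using assms by linarith
  then show ?thesis by cases (auto simp: jacobi_coeff_def N_def I_def)
qed

lemma jacobi_coeff_base3:
  fixes n i :: nat
  defines "N \<equiv> of_nat n" and "I \<equiv> of_nat i"
  assumes "1 \<le> n" and "i \<le> n + 3"
  shows "(if i < 3 then 0 else jacobi_coeff n (i - 3)) =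
      jacobi_scale n * (I * (I-1) * (I-2) * (8 * (4*N+2*I+3) * (4*N+2*I+1) * (4*N+2*I-1)))
           * (jacobi_base n i :: 'a::field_char_0)"
proof (cases "3 \<le> i")
  case True
  define j where "j = i - 3"
  define d where "d = n - j"
  have d: "n = j + d" "i = Suc (Suc (Suc j))" using True assms by (auto simp: j_def d_def)
  have 1: "fact (3 * n + 2 + j) = (fact (3 * n + i - 1) :: 'a)"
    using d by (simp add: N_def I_def algebra_simps)
  have 2: "fact (n + 3 - i) = (fact (n - j) :: 'a)"
    using d by (simp add: N_def I_def algebra_simps)
  have 4: "semifact (2 * n + j + 1) = 8 * (4*N+2*I+3) * (4*N+2*I+1) * (4*N+2*I-1) * (semifact (2 * n + i + 1) :: 'a)"
    using semifact_Suc[of "2 * n + j + 1", where 'a = 'a] semifact_Suc[of "2 * n + j + 2", where 'a = 'a]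
      semifact_Suc[of "2 * n + j + 3", where 'a = 'a]
     d by (simp add: N_def I_def eval_nat_numeral) (simp add: algebra_simps)
  have 5: "fact i = I * (I-1) * (I-2) * (fact j :: 'a)" "I \<noteq> 0" "I - 1 \<noteq> 0" "I - 2 \<noteq> 0"
    using d by (simp_all add: I_def)
  have 6: "j \<le> n" "i - 3 = j" using d by auto
  show ?thesis
    using d(2) unfolding 6(2) jacobi_coeff_alt[OF 6(1)] jacobi_base_def 1 2 4 5(1) using 5(2-)
    by (simp add: divide_simps)
next
  case False
  then consider "i = 0" | "i = 1" | "i = 2"  using assms by linarith
  then show ?thesis by cases (auto simp: jacobi_coeff_def N_def I_def)
qed

lemma jacobi_scale_Suc:
  fixes n :: nat
  defines "N \<equiv> of_nat n"
  shows "(4*N+3) * (4*N+5) * jacobi_scale (Suc n) = 3 * (6*N+5) * (6*N+7) * (jacobi_scale n :: 'a::field_char_0)"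
proof -
  have 1: "fact (6 * Suc n + 3) = (6*N+9)*(6*N+8)*(6*N+7)*(6*N+6)*(6*N+5)*(6*N+4) * (fact (6 * n + 3) :: 'a)"
    using fact_add3[of "6 * n + 3", where 'a = 'a] fact_add3[of "6 * n + 6", where 'a = 'a]
    by (simp add: N_def algebra_simps)
  have 2: "fact (4 * Suc n + 2) = (4*N+6)*(4*N+5)*(4*N+4)*(4*N+3) * (fact (4 * n + 2) :: 'a)"
    by (simp add: N_def eval_nat_numeral) (simp add: algebra_simps)
  have 3: "fact (3 * Suc n + 1) = (3*N+4)*(3*N+3)*(3*N+2) * (fact (3 * n + 1) :: 'a)"
    using fact_add3[of "3 * n + 1", where 'a = 'a] by (simp add: N_def algebra_simps)
  have 4: "fact (Suc n) = (N + 1) * (fact n :: 'a)" by (simp add: N_def)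
  have nz: "4 * N + 6 \<noteq> (0::'a)" "4 * N + 5 \<noteq> (0::'a)" "4 * N + 4 \<noteq> (0::'a)" "4 * N + 3 \<noteq> (0::'a)"
    "3 * N + 4 \<noteq> (0::'a)" "3 * N + 3 \<noteq> (0::'a)" "3 * N + 2 \<noteq> (0::'a)"
    using of_nat_plus_neq_0(2)[of "4 * n"] of_nat_plus_neq_0(2)[of "3 * n"]
    unfolding N_def by simp_all
  have "(4*N+3) * (4*N+5) * (jacobi_scale (Suc n) :: 'a) * ((4*N+6)*(4*N+4)*(3*N+4)*(3*N+3)*(3*N+2)) =
     jacobi_scale n * ((N + 1) * ((6*N+9)*(6*N+8)*(6*N+7)*(6*N+6)*(6*N+5)*(6*N+4)))"
    unfolding jacobi_scale_def 1 2 3 4 using nz by (simp add: divide_simps)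
  also have "\<dots> = 3 * (6*N+5) * (6*N+7) * jacobi_scale n * ((4*N+6)*(4*N+4)*(3*N+4)*(3*N+3)*(3*N+2))"
    by (simp add: algebra_simps)
  finally show ?thesis using nz by simp
qed

lemma jacobi_coeff_base_Suc:
  fixes n i :: nat
  defines "N \<equiv> of_nat n" and "I \<equiv> of_nat i"
  assumes "1 \<le> n" and "i \<le> n + 3"
  shows "(if i < 2 then 0 else jacobi_coeff (Suc n) (i - 2)) =
      jacobi_scale (Suc n) * ((3*N+I+3) * (3*N+I+2) * (3*N+I+1) * (3*N+I) * I * (I-1))
           * (jacobi_base n i :: 'a::field_char_0)"
proof (cases "2 \<le> i")
  case True
  define j where "j = i - 2"
  define d where "d = Suc n - j"
  have d: "Suc n = j + d" "i = Suc (Suc j)" using True assms by (auto simp: j_def d_def)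
  have "3 * Suc n + 2 + j = Suc (3 * n + i - 1 + 3)" using d assms(3) by simp
  then have "fact (3 * Suc n + 2 + j) = (of_nat (3 * n + i - 1) + 4) * (fact (3 * n + i - 1 + 3) :: 'a)"
    by (simp only: fact_Suc) simp
  moreover have "of_nat (3 * n + i - 1) = (3*N+I-1 :: 'a)"
    using assms(3) by (simp add: N_def I_def of_nat_diff)
  ultimately have 1: "fact (3 * Suc n + 2 + j) =
      (3*N+I+3) * (3*N+I+2) * (3*N+I+1) * (3*N+I) * (fact (3 * n + i - 1) :: 'a)"
    unfolding fact_add3 by (simp add: ac_simps)
  have 2: "fact (n + 3 - i) = (fact (Suc n - j) :: 'a)"
    using d by (simp add: N_def I_def algebra_simps)
  have "2 * Suc n + j + 1 = 2 * n + i + 1" using d by simp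
  then have 4: "semifact (2 * Suc n + j + 1) = (semifact (2 * n + i + 1) :: 'a)" by (simp only:)
  have 5: "fact i = I * (I-1) * (fact j :: 'a)" "I \<noteq> 0" "I - 1 \<noteq> 0" using d by (simp_all add: I_def)
  have 6: "j \<le> Suc n" "i - 2 = j" using d by auto
  show ?thesis
    using d(2) unfolding 6(2) jacobi_coeff_alt[OF 6(1)] jacobi_base_def 1 2 4 5(1) using 5(2-)
    by (simp add: divide_simps)
next
  case False
  then consider "i = 0" | "i = 1" using assms by linarith
  then show ?thesis by cases (auto simp: jacobi_coeff_def N_def I_def)
qed

lemma jacobi_coeff_base_pred:
  fixes n i :: nat
  defines "N \<equiv> of_nat n" and "I \<equiv> of_nat i"
  assumes "1 \<le> n" and "i \<le> n + 3"
  shows "jacobi_coeff (n - 1) i =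
      jacobi_scale (n - 1) * ((N+3-I) * (N+2-I) * (N+1-I) * (N-I) * (4 * (4*N+2*I+3) * (4*N+2*I+1)))
           * (jacobi_base n i :: 'a::field_char_0)"
proof (cases "i \<le> n - 1")
  case True
  define d where "d = n - 1 - i"
  define m where "m = n - 1"
  have d: "n = Suc (i + d)" "n = Suc m" "m = i + d" using True assms by (auto simp: d_def m_def)
  have 1: "fact (3 * m + 2 + i) = (fact (3 * n + i - 1) :: 'a)"
    using d by (simp add: algebra_simps)
  have 2: "fact (n + 3 - i) = (N+3-I) * (N+2-I) * (N+1-I) * (N-I) * (fact (m - i) :: 'a)"
    using fact_add3[of "Suc d", where 'a = 'a] by (simp add: N_def I_def d algebra_simps)
  have 3: "(N+3-I) * (N+2-I) * (N+1-I) * (N-I) \<noteq> 0"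
    by (simp add: N_def I_def d add.assoc[symmetric])
  have 4: "semifact (2 * m + i + 1) = 4 * (4*N+2*I+3) * (4*N+2*I+1) * (semifact (2 * n + i + 1) :: 'a)"
    using semifact_Suc[of "2 * m + i + 1", where 'a = 'a] semifact_Suc[of "2 * m + i + 2", where 'a = 'a]
     d(2) by (simp add: N_def I_def algebra_simps)
  have 6: "i \<le> m" "n - 1 = m" using d by auto
  show ?thesis
    unfolding 6(2) jacobi_coeff_alt[OF 6(1)] jacobi_base_def 1 2 4 using 3
    by (simp add: divide_simps)
next
  case False
  then consider "i = n" | "i = n + 1" | "i = n + 2" | "i = n + 3" using assms by linarith
  then show ?thesis by cases (use assms in \<open>auto simp: jacobi_coeff_def\<close>)
qed

text \<open>The numbers \<open>\<alpha>\<^sub>n\<close> and \<open>\<beta>\<^sub>n\<close> of the three-term recurrence. A comparison of the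
  coefficients of \<open>T^0\<close> and \<open>T^1\<close> there determines them.\<close>

definition rec_alpha :: "nat \<Rightarrow> 'a::field_char_0" where
  "rec_alpha n = of_nat (54 * n ^ 2 + 81 * n + 15) / of_nat ((4 * n + 5) * (4 * n + 1))"

definition rec_beta :: "nat \<Rightarrow> 'a::field_char_0" where
  "rec_beta n = of_nat (9 * (3 * n + 2) * (3 * n + 1) * (6 * n + 1) * (6 * n - 1)) /
     of_nat (4 * (4 * n + 1) ^ 2 * (4 * n - 1) * (4 * n + 3))"

text \<open>This is the comparison of the coefficients of \<open>T^i\<close> in the three-term recurrence. Division by
  the common term leaves an identity of rational functions in \<open>n\<close> and \<open>i\<close>.\<close>

lemma jacobi_coeff_recurrence:
  assumes "1 \<le> n"
  shows "(if i < 2 then 0 else jacobi_coeff (Suc n) (i - 2)) =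
     jacobi_coeff n i + (3 - rec_alpha n) * (if i < 1 then 0 else jacobi_coeff n (i - 1))
     + 3 * (if i < 2 then 0 else jacobi_coeff n (i - 2))
     + (if i < 3 then 0 else jacobi_coeff n (i - 3)) - rec_beta n * (jacobi_coeff (n - 1) i :: 'a::field_char_0)"
proof (cases "i \<le> n + 3")
  case True
  define N I where "N = (of_nat n :: 'a)" and "I = (of_nat i :: 'a)"
  obtain m where m: "n = Suc m" using assms by (cases n) auto
  have nz: "4*N+1 \<noteq> 0" "4*N+3 \<noteq> 0" "4*N+5 \<noteq> 0" "4*N-1 \<noteq> 0" "6*N-1 \<noteq> 0" "6*N+1 \<noteq> 0"
    using of_nat_plus_neq_0[where m = "4 * n" and 'a = 'a] of_nat_plus_neq_0(2)[where m = "4 * m" and 'a = 'a]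
      of_nat_plus_neq_0[where m = "6 * n" and 'a = 'a] of_nat_plus_neq_0(2)[where m = "6 * m" and 'a = 'a]
    by (simp_all add: N_def m algebra_simps)
  have pred: "(4*N-1) * (4*N+1) * jacobi_scale n = 3 * (6*N-1) * (6*N+1) * jacobi_scale (n - 1)"
    using jacobi_scale_Suc[of m, where 'a = 'a] by (simp add: m N_def algebra_simps)
  have "of_nat (6 * n - 1) = 6*N-1" "of_nat (4 * n - 1) = 4*N-1"
    by (simp_all add: m N_def)
  then have beta: "rec_beta n = 9 * (3*N+2) * (3*N+1) * (6*N+1) * (6*N-1) /
     (4 * (4*N+1)^2 * (4*N-1) * (4*N+3))"
    unfolding rec_beta_def
    by (simp only: of_nat_mult of_nat_power of_nat_add of_nat_numeral of_nat_1 N_def)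
  have alpha: "rec_alpha n = (54 * N^2 + 81 * N + 15) / ((4*N+5) * (4*N+1))"
    unfolding rec_alpha_def
    by (simp only: of_nat_mult of_nat_power of_nat_add of_nat_numeral of_nat_1 N_def)
  have beta_scale: "rec_beta n * jacobi_scale (n - 1) =
      3 * (3*N+2) * (3*N+1) / (4 * (4*N+1) * (4*N+3)) * jacobi_scale n"
  proof -
    have "jacobi_scale n = (4*N-1) * (4*N+1) * jacobi_scale n / ((4*N-1) * (4*N+1))"
      using nz by simp
    also have "\<dots> = 3 * (6*N-1) * (6*N+1) * jacobi_scale (n - 1) / ((4*N-1) * (4*N+1))"
      by (simp only: pred)
    finally have "jacobi_scale n = 3 * (6*N-1) * (6*N+1) * jacobi_scale (n - 1) / ((4*N-1) * (4*N+1))" .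
    note scale = this
    have "9 * u * v * q * p / (4 * a^2 * b * c) * g = 3 * u * v / (4 * a * c) * (3 * p * q * g / (b * a))"
      if "a \<noteq> 0" "b \<noteq> 0" "c \<noteq> 0" for a b c g p q u v :: 'a
      using that by (simp add: field_simps power2_eq_square)
    from this[OF nz(1,4,2)] show ?thesis unfolding beta scale .
  qed
  have suc_scale: "jacobi_scale (Suc n) = 3 * (6*N+5) * (6*N+7) / ((4*N+3) * (4*N+5)) * jacobi_scale n"
  proof -
    have "jacobi_scale (Suc n) = (4*N+3) * (4*N+5) * jacobi_scale (Suc n) / ((4*N+3) * (4*N+5))"
      using nz by simp
    also have "\<dots> = 3 * (6*N+5) * (6*N+7) * jacobi_scale n / ((4*N+3) * (4*N+5))"
      unfolding N_def by (simp only: jacobi_scale_Suc)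
    finally show ?thesis by simp
  qed
  have key: "3 * (6*N+5) * (6*N+7) / ((4*N+3) * (4*N+5)) * ((3*N+I+3) * (3*N+I+2) * (3*N+I+1) * (3*N+I) * I * (I-1)) =
      (3*N+I+2) * (3*N+I+1) * (3*N+I) * (N+3-I) * (N+2-I) * (N+1-I)
      + (3 - rec_alpha n) * ((3*N+I+1) * (3*N+I) * I * (N+3-I) * (N+2-I) * (2 * (4*N+2*I+3)))
      + 3 * ((3*N+I) * I * (I-1) * (N+3-I) * (4 * (4*N+2*I+3) * (4*N+2*I+1)))
      + I * (I-1) * (I-2) * (8 * (4*N+2*I+3) * (4*N+2*I+1) * (4*N+2*I-1))
      - 3 * (3*N+2) * (3*N+1) / (4 * (4*N+1) * (4*N+3)) *
        ((N+3-I) * (N+2-I) * (N+1-I) * (N-I) * (4 * (4*N+2*I+3) * (4*N+2*I+1)))" (is "?L = ?R")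
  proof -
    have L: "x / (b * c) * y * (a * b * c) = x * a * y" if "b \<noteq> 0" "c \<noteq> 0" for a b c x y :: 'a
      using that by simp
    have R: "(t + (3 - z / (c * a)) * u + v + w - x / (4 * a * b) * (y * (4 * p * q))) * (a * b * c) =
        (t + v + w) * (a * b * c) + (3 * (a * c) - z) * b * u - x * c * (y * (p * q))"
      if "a \<noteq> 0" "b \<noteq> 0" "c \<noteq> 0" for a b c p q t u v w x y z :: 'a
      using that by (simp add: field_simps)
    have "?L * ((4*N+1)*(4*N+3)*(4*N+5)) = ?R * ((4*N+1)*(4*N+3)*(4*N+5))"
      unfolding alpha L[OF nz(2,3)] R[OF nz(1,2,3)]
      by (simp add: algebra_simps power2_eq_square)
    moreover have "(4*N+1)*(4*N+3)*(4*N+5) \<noteq> 0" using nz by simp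
    ultimately show ?thesis by (rule iffD1[OF mult_right_cancel, rotated])
  qed
  \<comment> \<open>With variables in place of the large polynomial factors, the simplifier does not expand these.\<close>
  have combine: "k * s * x * b = s * t * b + c * (s * u * b) + 3 * (s * v * b) + s * w * b - z * (r * y * b)"
    if "k * x = t + c * u + 3 * v + w - h * y" and "z * r = h * s" for b c h k r s t u v w x y z :: 'a
  proof -
    have "k * s * x * b = (k * x) * (s * b)" by (simp only: mult_ac)
    also have "\<dots> = s * t * b + c * (s * u * b) + 3 * (s * v * b) + s * w * b - (h * s) * y * b"
      unfolding that(1) by (simp add: algebra_simps)
    also have "(h * s) * y * b = z * (r * y * b)"
      unfolding that(2)[symmetric] by (simp only: mult_ac)
    finally show ?thesis .
  qed
  show ?thesis
    unfolding jacobi_coeff_base0[OF assms True] jacobi_coeff_base1[OF assms True] jacobi_coeff_base2[OF assms True]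
      jacobi_coeff_base3[OF assms True] jacobi_coeff_base_Suc[OF assms True] jacobi_coeff_base_pred[OF assms True]
      suc_scale N_def[symmetric] I_def[symmetric]
    by (rule combine[OF key beta_scale])
next
  case False
  then have "\<not> i \<le> n" "\<not> i - 1 \<le> n" "\<not> i - 2 \<le> n" "\<not> i - 3 \<le> n" "\<not> i \<le> n - 1" "\<not> i - 2 \<le> Suc n"
    by linarith+
  then show ?thesis by (simp only: jacobi_coeff_def) simp
qed

lemma jacobi_poly_recurrence:
  assumes "1 \<le> n"
  shows "monom 1 2 * jacobi_poly (Suc n) =
    ([:1, 1:] ^ 3 - smult (rec_alpha n) [:0, 1:]) * jacobi_poly n - smult (rec_beta n) (jacobi_poly (n - 1) :: 'a::field_char_0 poly)"
proof (rule poly_eqI)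
  fix i
  have 1: "[:1, 1:] ^ 3 = 1 + smult 3 (monom (1::'a) 1) + smult 3 (monom 1 2) + monom 1 3"
    by (simp add: eval_nat_numeral monom_Suc one_pCons)
  have 2: "[:0, 1:] = monom (1::'a) 1"
    by (simp add: monom_Suc)
  have "coeff (monom 1 2 * jacobi_poly (Suc n)) i = (if i < 2 then 0 else jacobi_coeff (Suc n) (i - 2) :: 'a)"
    by (auto simp: coeff_monom_mult coeff_jacobi)
  also have "\<dots> = jacobi_coeff n i + (3 - rec_alpha n) * (if i < 1 then 0 else jacobi_coeff n (i - 1))
     + 3 * (if i < 2 then 0 else jacobi_coeff n (i - 2))
     + (if i < 3 then 0 else jacobi_coeff n (i - 3)) - rec_beta n * jacobi_coeff (n - 1) i"
    by (rule jacobi_coeff_recurrence[OF assms])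
  also have "\<dots> = coeff (jacobi_poly n) i + (3 - rec_alpha n) * coeff (monom 1 1 * jacobi_poly n) i
     + 3 * coeff (monom 1 2 * jacobi_poly n) i
     + coeff (monom 1 3 * jacobi_poly n) i - rec_beta n * coeff (jacobi_poly (n - 1)) i"
    by (auto simp: coeff_monom_mult coeff_jacobi)
  also have "\<dots> = coeff (([:1, 1:] ^ 3 - smult (rec_alpha n) [:0, 1:]) * jacobi_poly n
      - smult (rec_beta n) (jacobi_poly (n - 1))) i"
    unfolding 1 2 distrib_right left_diff_distrib coeff_add coeff_diff mult_smult_left coeff_smult
    by simp
  finally show "coeff (monom 1 2 * jacobi_poly (Suc n)) i =
    coeff (([:1, 1:] ^ 3 - smult (rec_alpha n) [:0, 1:]) * jacobi_poly n - smult (rec_beta n) (jacobi_poly (n - 1) :: 'a poly)) i" .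
qed

lemma jacobi_poly_0: "jacobi_poly 0 = 1"
  by (simp add: jacobi_poly_def jacobi_coeff_def monom_0 one_pCons eval_nat_numeral)

lemma jacobi_poly_1: "jacobi_poly (Suc 0) = [:3, 1:]"
proof (rule poly_eqI)
  fix i :: nat
  consider "i = 0" | "i = 1" | "i > 1" by linarith
  then show "coeff (jacobi_poly (Suc 0)) i = coeff [:3, 1 :: 'a:] i"
    by cases (auto simp: coeff_jacobi jacobi_coeff_def eval_nat_numeral coeff_pCons split: nat.split)
qed

lemma monom_jacobi_step:
  assumes "1 \<le> n"
  shows "[:0, 1:] * (monom 1 (Suc n) * jacobi_poly (Suc n)) =
    [:1, 1:] ^ 3 * (monom 1 n * jacobi_poly n) - [:0, 1:] * (smult (rec_alpha n) (monom 1 n * jacobi_poly n)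
      + smult (rec_beta n) (monom 1 (n - 1) * jacobi_poly (n - 1) :: 'a::field_char_0 poly))"
proof -
  obtain m where m: "n = Suc m" using assms by (cases n) auto
  have 1: "monom (1::'a) (Suc k) = [:0, 1:] * monom 1 k" for k by (simp add: monom_Suc)
  have 2: "monom (1::'a) 2 = [:0, 1:] * [:0, 1:]" by (simp add: eval_nat_numeral monom_Suc)
  have smult: "smult c p = [:c:] * p" for c :: 'a and p by simp
  have expand: "t * (t * (t * w) * g2) = c * (t * w * g1) - t * (a * (t * w * g1) + b * (w * g0))"
    if "t * t * g2 = (c - a * t) * g1 - b * g0" for a b c g0 g1 g2 t w :: "'a poly"
  proof -
    have "t * (t * (t * w) * g2) = t * w * (t * t * g2)" by (simp only: mult_ac)
    then show ?thesis unfolding that by (simp add: algebra_simps)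
  qed
  show ?thesis using jacobi_poly_recurrence[OF assms, where 'a = 'a]
    unfolding m 1 2 smult diff_Suc_1 by (rule expand)
qed

text \<open>Induction along the three-term recurrence. For \<open>n > 0\<close> the polynomial \<open>T^n p\<^sub>n\<close> vanishes at 0,
  and so do all \<open>g\<^sub>j\<close> except \<open>g\<^sub>0 = 1\<close>; hence \<open>g\<^sub>0\<close> does not occur in its expansion, and
  lemma \<open>cubic_mult_path_poly\<close> applies to all terms.\<close>

lemma monom_jacobi_in_path_span:
  "\<exists>r \<in> path_span n. monom 1 n * jacobi_poly n = path_poly n + (r :: 'a::field_char_0 poly)"
proof (induction n rule: less_induct)
  case (less n)
  consider "n = 0" | "n = 1" | m where "n = Suc m" "1 \<le> m"
    by (cases n rule: nat.exhaust; cases "n = 1") auto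
  then show ?case
  proof cases
    case 1
    then show ?thesis using path_span_0 by (intro bexI[of _ 0]) (simp_all add: jacobi_poly_0)
  next
    case 2
    then show ?thesis using path_span_0 by (intro bexI[of _ 0]) (simp_all add: jacobi_poly_1 monom_Suc)
  next
    case 3
    obtain k where k: "m = Suc k" using 3 by (cases m) auto
    define q :: "nat \<Rightarrow> 'a poly" where "q i = monom 1 i * jacobi_poly i" for i
    obtain r where r: "r \<in> path_span m" "q m = path_poly m + r"
      using less.IH[of m] 3 by (auto simp: q_def)
    obtain b where b: "r = (\<Sum>j<m. smult (b j) (path_poly j))" using r(1) by (auto simp: path_span_def)
    have "coeff (q m) 0 = 0" using 3 by (simp add: q_def coeff_monom_mult)
    moreover have "coeff (q m) 0 = b 0"
      using 3(2) unfolding r(2) b by (simp add: coeff_sum coeff_path_poly_0 k sum.lessThan_Suc_shift del: sum.lessThan_Suc)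
    ultimately have b0: "b 0 = 0" by simp
    have r': "r = (\<Sum>j<k. smult (b (Suc j)) (path_poly (Suc j)))"
      unfolding b k by (simp add: sum.lessThan_Suc_shift b0 del: sum.lessThan_Suc)
    define e :: "nat \<Rightarrow> 'a poly" where "e j = 3 * path_poly (Suc j) + 3 * path_poly j
      + (case j of 0 \<Rightarrow> 0 | Suc i \<Rightarrow> path_poly i)" for j
    have numeral_smult: "3 * p = smult 3 p" for p :: "'a poly" by (simp add: numeral_poly)
    have e_span: "e j \<in> path_span n" if "j \<le> k" for j
      unfolding e_def numeral_smult using that 3(1) k
      by (auto intro!: path_span_add path_span_smult path_poly_in_span path_span_0 simp del: path_poly.simps split: nat.split)
    have cubic: "[:1, 1:] ^ 3 * path_poly (Suc j) = [:0, 1:] * (path_poly (Suc (Suc j)) + e j)" for j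
      unfolding cubic_mult_path_poly e_def by (simp add: add.assoc)
    \<comment> \<open>The top term \<open>g\<^sub>m\<close> of \<open>T^m p\<^sub>m\<close> yields \<open>g\<^sub>n\<close>; the following remainder collects all other terms.\<close>
    define r' where "r' = e k + (\<Sum>j<k. smult (b (Suc j)) (path_poly (Suc (Suc j)) + e j))
        + (smult (- rec_alpha m) (q m) + smult (- rec_beta m) (q k))"
    have "[:0, 1:] * q n = [:1, 1:] ^ 3 * q m - [:0, 1:] * (smult (rec_alpha m) (q m) + smult (rec_beta m) (q k))"
      using monom_jacobi_step[OF 3(2), where 'a = 'a] 3(1) k by (simp add: q_def)
    also have "[:1, 1:] ^ 3 * q m = [:1, 1:] ^ 3 * path_poly (Suc k) +
        (\<Sum>j<k. smult (b (Suc j)) ([:1, 1:] ^ 3 * path_poly (Suc j)))"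
      unfolding r(2) unfolding r' k by (simp only: distrib_left sum_distrib_left mult_smult_right)
    also have "\<dots> = [:0, 1:] * (path_poly n + e k + (\<Sum>j<k. smult (b (Suc j)) (path_poly (Suc (Suc j)) + e j)))"
      unfolding cubic by (simp only: distrib_left sum_distrib_left mult_smult_right 3(1) k)
    finally have "[:0, 1:] * q n = [:0, 1:] * (path_poly n + r')"
      unfolding r'_def by (simp add: algebra_simps)
    then have "q n = path_poly n + r'" by (subst (asm) mult_left_cancel) simp_all
    moreover have "r' \<in> path_span n"
    proof -
      have "q m \<in> path_span n"
        unfolding r(2) using r(1) path_span_mono[of m n] 3(1)
        by (auto intro!: path_span_add path_poly_in_span)
      moreover obtain r2 where "r2 \<in> path_span k" "q k = path_poly k + r2"
        using less.IH[of k] 3 k by (auto simp: q_def)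
      then have "q k \<in> path_span n"
        using path_span_mono[of k n] 3(1) k
        by (auto intro!: path_span_add path_poly_in_span)
      ultimately show ?thesis
        unfolding r'_def
        by (intro path_span_add path_span_sum path_span_smult e_span path_poly_in_span)
          (use 3(1) k in auto)
    qed
    ultimately show ?thesis by (auto simp: q_def)
  qed
qed

section \<open>Evaluation of the determinant\<close>

text \<open>The upper triangular matrix \<open>r\<close> subtracts \<open>c\<close> times row \<open>i + 1\<close> from row \<open>i\<close>, which turns the
  coefficients of a divided difference into those of the polynomial itself, except in the last row.
  The upper triangular matrix \<open>t\<close> replaces the last column by the divided difference of
  \<open>T^n p\<^sub>n\<close>, a polynomial without terms of degree less than \<open>n\<close>.\<close>

lemma det_shift_quot:
  fixes c :: "'a::field_char_0"
  shows "det (mat (Suc n) (Suc n) (\<lambda>(i, j). coeff (shift_quot c (path_poly j)) i)) =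
    det (mat n n (\<lambda>(i, j). coeff (path_poly j) i)) * poly (jacobi_poly n) c"
proof -
  obtain b where b: "monom 1 n * jacobi_poly n = path_poly n + (\<Sum>j<n. smult (b j) (path_poly j :: 'a poly))"
    using monom_jacobi_in_path_span[of n, where 'a = 'a] by (auto simp: path_span_def)
  define r where "r i k = (if k = i then 1 else if k = Suc i then - c else 0)" for i k
  define t where "t k j = (if k = j then 1 else if j = n \<and> k < n then b k else 0)" for k j
  define v where "v j = (if j = n then shift_quot c (monom 1 n * jacobi_poly n) else shift_quot c (path_poly j))" for j
  define X where "X = det (mat (Suc n) (Suc n) (\<lambda>(i, j). coeff (shift_quot c (path_poly j)) i))"
  have t: "(\<Sum>l<Suc n. coeff (shift_quot c (path_poly l)) k * t l j) = coeff (v j) k" if "j \<le> n" for j k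
  proof (cases "j = n")
    case True
    have "(\<Sum>l<n. coeff (shift_quot c (path_poly l)) k * t l j) = (\<Sum>l<n. coeff (shift_quot c (path_poly l)) k * b l)"
      by (rule sum.cong) (auto simp: t_def True)
    moreover have "coeff (v j) k = coeff (shift_quot c (path_poly n)) k + (\<Sum>l<n. coeff (shift_quot c (path_poly l)) k * b l)"
      using True unfolding v_def b shift_quot_add shift_quot_sum shift_quot_smult
      by (simp add: coeff_sum mult.commute)
    ultimately show ?thesis using True by (simp add: t_def)
  next
    case False
    then have "(\<Sum>l<Suc n. coeff (shift_quot c (path_poly l)) k * t l j) =
       (\<Sum>l<Suc n. if l = j then coeff (shift_quot c (path_poly l)) k else 0)"
      by (intro sum.cong) (auto simp: t_def)
    also have "\<dots> = coeff (v j) k" using False that by (simp add: v_def)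
    finally show ?thesis .
  qed
  have r: "(\<Sum>k<Suc n. r i k * h k) = (if i = n then h n else h i - c * h (Suc i))" if "i \<le> n" for i and h :: "nat \<Rightarrow> 'a"
  proof -
    have "(\<Sum>k<Suc n. r i k * h k) = (\<Sum>k<Suc n. (if k = i then h k else 0) + (if k = Suc i then - c * h k else 0))"
      by (intro sum.cong) (auto simp: r_def)
    also have "\<dots> = (if i = n then h n else h i - c * h (Suc i))"
      using that unfolding sum.distrib by (auto simp: less_Suc_eq_le simp del: sum.lessThan_Suc)
    finally show ?thesis .
  qed
  have "X = det (mat (Suc n) (Suc n) (\<lambda>(i, j). r i j)) * (X * det (mat (Suc n) (Suc n) (\<lambda>(i, j). t i j)))"
  proof -
    have "det (mat (Suc n) (Suc n) (\<lambda>(i, j). r i j)) = 1"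
      by (rule det_unit_upper_triangular) (auto simp: r_def)
    moreover have "det (mat (Suc n) (Suc n) (\<lambda>(i, j). t i j)) = 1"
      by (rule det_unit_upper_triangular) (auto simp: t_def)
    ultimately show ?thesis by simp
  qed
  also have "\<dots> = det (mat (Suc n) (Suc n)
      (\<lambda>(i, j). \<Sum>k<Suc n. r i k * (\<Sum>l<Suc n. coeff (shift_quot c (path_poly l)) k * t l j)))"
    unfolding X_def det_mat_mult[where f = r]
      det_mat_mult[where f = "\<lambda>i j. coeff (shift_quot c (path_poly j)) i" and g = t] ..
  also have "mat (Suc n) (Suc n)
      (\<lambda>(i, j). \<Sum>k<Suc n. r i k * (\<Sum>l<Suc n. coeff (shift_quot c (path_poly l)) k * t l j)) =
    four_block_mat (mat n n (\<lambda>(i, j). coeff (path_poly j) i)) (0\<^sub>m n 1)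
      (mat 1 n (\<lambda>(i, j). coeff (v j) n)) (mat 1 1 (\<lambda>_. poly (jacobi_poly n) c))" (is "?L = ?R")
  proof (rule eq_matI)
    fix i j assume "i < dim_row ?R" "j < dim_col ?R"
    then have ij: "i \<le> n" "j \<le> n" by auto
    have "?L $$ (i, j) = (if i = n then coeff (v j) n else coeff (v j) i - c * coeff (v j) (Suc i))"
      using ij by (simp add: t r del: sum.lessThan_Suc)
    also have "\<dots> = ?R $$ (i, j)"
      using ij coeff_shift_quot_monom[of c n "jacobi_poly n"] coeff_shift_quot[of c "monom 1 n * jacobi_poly n" i]
        coeff_shift_quot[of c "path_poly j" i]
      by (auto simp: v_def coeff_monom_mult)
    finally show "?L $$ (i, j) = ?R $$ (i, j)" .
  qed auto
  also have "det \<dots> = det (mat n n (\<lambda>(i, j). coeff (path_poly j) i)) * poly (jacobi_poly n) c"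
    by (subst det_four_block_mat_upper_right_zero_col[of _ n]) (auto simp: det_single)
  finally show ?thesis by (simp add: X_def)
qed

text \<open>At \<open>x = 1\<close> the divided differences are taken at 0 and coincide with the \<open>g\<^sub>j\<close>, so that the
  determinant left over in lemma \<open>det_shift_quot\<close> is itself a Hankel determinant.\<close>

lemma hankel_det_Suc:
  fixes x :: "'a::field_char_0"
  shows "hankel_det (Suc n) x = hankel_det n 1 * poly (jacobi_poly (Suc n)) (- 2 * (x - 1))"
proof -
  have "hankel_det n (1 :: 'a) = det (mat (Suc n) (Suc n) (\<lambda>(i, j). coeff (path_poly j) i))"
    by (simp add: hankel_det_eq_det_shift_quot shift_quot_0)
  then show ?thesis
    by (simp only: hankel_det_eq_det_shift_quot[of "Suc n"] det_shift_quot)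
qed

lemma hankel_det_0: "hankel_det 0 x = 1"
  by (simp add: hankel_det_def hankel_coeff_def det_single)

lemma hankel_det_1: "hankel_det n 1 = (\<Prod>i=1..n. jacobi_coeff i 0 :: 'a::field_char_0)"
proof (induction n)
  case (Suc n)
  then show ?case by (simp add: hankel_det_Suc poly_0_coeff_0 coeff_jacobi)
qed (simp add: hankel_det_0)

lemma jacobi_coeff_0_eq:
  "jacobi_coeff i 0 = (fact (6 * i + 4) * fact (2 * i + 1) / (2 * fact (4 * i + 2) * fact (4 * i + 3)) :: 'a::field_char_0)"
proof -
  have "fact (6 * i + 4) = (2 * (3 * of_nat i + 2)) * (fact (6 * i + 3) :: 'a)"
    using fact_Suc[of "6 * i + 3", where 'a = 'a] by (simp add: algebra_simps)
  moreover have "fact (3 * i + 2) = (3 * of_nat i + 2) * (fact (3 * i + 1) :: 'a)"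
    using fact_Suc[of "3 * i + 1", where 'a = 'a] by (simp add: algebra_simps)
  ultimately show ?thesis
    by (simp add: jacobi_coeff_def field_simps del: fact_Suc)
qed

lemma fact_odd_eq_dfact: "fact (2 * k + 1) = dfact (2 * k + 1) * 2 ^ k * fact k"
proof (induction k)
  case (Suc k)
  have "fact (2 * Suc k + 1) = (2 * k + 3) * (2 * k + 2) * (fact (2 * k + 1) :: nat)"
    by (simp add: algebra_simps)
  also have "\<dots> = (2 * k + 3) * dfact (2 * k + 1) * 2 ^ Suc k * ((k + 1) * fact k)"
    unfolding Suc.IH by (simp add: algebra_simps)
  also have "\<dots> = dfact (2 * Suc k + 1) * 2 ^ Suc k * fact (Suc k)"
    by (simp add: algebra_simps)
  finally show ?case .
qed simp

lemma of_nat_dfact: "of_nat (dfact (2 * k + 1)) = (1 / (2 ^ k * semifact k) :: 'a::field_char_0)"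
proof -
  have "fact (2 * k + 1) = of_nat (dfact (2 * k + 1)) * 2 ^ k * (fact k :: 'a)"
    using arg_cong[OF fact_odd_eq_dfact[of k], of "of_nat :: nat \<Rightarrow> 'a"]
    by (simp only: of_nat_mult of_nat_power of_nat_numeral of_nat_fact)
  then show ?thesis by (simp add: semifact_def del: fact_Suc)
qed

lemma semifact_nonzero: "semifact k \<noteq> (0 :: 'a::field_char_0)"
  by (simp add: semifact_def del: fact_Suc)

lemma poly_jacobi:
  fixes s :: "'a::field_char_0"
  shows "poly (jacobi_poly n) (- 2 * s) = jacobi_coeff n 0 *
    (\<Sum>i=0..n. ((-1) ^ i * fact n * of_nat (dfact (4 * n + 3)) * fact (3 * n + i + 2) * s ^ i) /
                (fact (3 * n + 2) * fact i * fact (n - i) * of_nat (dfact (4 * n + 2 * i + 3))))"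
proof -
  have "jacobi_coeff n i * (- 2 * s) ^ i = jacobi_coeff n 0 *
     (((-1) ^ i * fact n * of_nat (dfact (4 * n + 3)) * fact (3 * n + i + 2) * s ^ i) /
                (fact (3 * n + 2) * fact i * fact (n - i) * of_nat (dfact (4 * n + 2 * i + 3))))"
    if "i \<le> n" for i
  proof -
    have sign: "(- 2 * s) ^ i = (-1) ^ i * 2 ^ i * s ^ i"
    proof -
      have "- 2 * s = (- 1) * 2 * s" by simp
      then show ?thesis by (simp only: power_mult_distrib)
    qed
    have d0: "of_nat (dfact (4 * n + 3)) = (1 / (2 ^ (2 * n + 1) * semifact (2 * n + 1)) :: 'a)"
    proof -
      have "4 * n + 3 = 2 * (2 * n + 1) + 1" by simp
      then show ?thesis by (simp only: of_nat_dfact)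
    qed
    have di: "of_nat (dfact (4 * n + 2 * i + 3)) = (1 / (2 ^ (2 * n + 1) * 2 ^ i * semifact (2 * n + i + 1)) :: 'a)"
    proof -
      have "4 * n + 2 * i + 3 = 2 * (2 * n + i + 1) + 1" "2 * n + i + 1 = 2 * n + 1 + i" by simp_all
      then show ?thesis by (simp only: of_nat_dfact power_add)
    qed
    have e: "3 * n + i + 2 = 3 * n + 2 + i" by simp
    have cancel: "g * (f * h / (p * q)) * (a * t * u) =
        g * (w * k / (1 * l)) * (a * l * (1 / (b * k)) * f * u / (w * p * q * (1 / (b * t * h))))"
      if "w \<noteq> 0" "k \<noteq> 0" "l \<noteq> 0" "b \<noteq> 0" "t \<noteq> 0" "h \<noteq> 0"
      for a b f g h k l p q t u w :: 'a
      using that by (simp add: field_simps)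
    show ?thesis
      unfolding jacobi_coeff_alt[OF that] jacobi_coeff_alt[OF le0] sign d0 di e
      unfolding fact_0 add_0_right diff_zero
      by (rule cancel) (simp_all add: semifact_nonzero del: fact_Suc)
  qed
  then show ?thesis
    by (simp add: jacobi_poly_def poly_sum poly_monom sum_distrib_left atLeast0AtMost)
qed

theorem theorem10:
  fixes n :: nat and x :: "'a::field_char_0"
  shows "hankel_det n x =
    (\<Prod>i=1..n. (fact (6 * i + 4) * fact (2 * i + 1)) /
                (2 * fact (4 * i + 2) * fact (4 * i + 3))) *
    (\<Sum>i=0..n. ((-1) ^ i * fact n * of_nat (dfact (4 * n + 3)) * fact (3 * n + i + 2) * (x - 1) ^ i) /
                (fact (3 * n + 2) * fact i * fact (n - i) * of_nat (dfact (4 * n + 2 * i + 3))))"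
proof -
  have "hankel_det n x = (\<Prod>i=1..n. jacobi_coeff i 0) *
      (\<Sum>i=0..n. ((-1) ^ i * fact n * of_nat (dfact (4 * n + 3)) * fact (3 * n + i + 2) * (x - 1) ^ i) /
                (fact (3 * n + 2) * fact i * fact (n - i) * of_nat (dfact (4 * n + 2 * i + 3))))"
  proof (cases n)
    case 0
    then show ?thesis by (simp add: hankel_det_0 numeral_3_eq_3 numeral_2_eq_2)
  next
    case (Suc m)
    have "(\<Prod>i=1..Suc m. jacobi_coeff i 0 :: 'a) = jacobi_coeff (Suc m) 0 * (\<Prod>i=1..m. jacobi_coeff i 0)"
      by (rule prod.nat_ivl_Suc') simp
    then show ?thesis unfolding Suc hankel_det_Suc poly_jacobi hankel_det_1 by (simp only: mult_ac)
  qed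
  then show ?thesis by (simp only: jacobi_coeff_0_eq)
qed

end
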